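(* Let $\gamma(\cdot,t)$, $t\in[0,T)$, be a smooth family of closed embedded curves in the plane $\mathbb{R}^2$ evolving by the curve shortening flow $\frac{\partial\gamma}{\partial t}=\kappa\mathbf{N}$, whose initial curve is convex, with curvature $\kappa>0$ everywhere. Then for every time $t\in(0,T)$ and at every point of the curve, $$\kappa_t+\frac{1}{2t}\kappa\geq\frac{\kappa_s^2}{\kappa},$$ where $s$ is the arc-length parameter of the curve and $\kappa=\kappa(s,t)$ is its curvature.
   Context: A family of closed embedded planar curves is a smooth map $\gamma:\mathbb{R}\times[0,T)\to\mathbb{R}^2$, $(x,t)\mapsto\gamma(x,t)$, such that for each $t$ the map $\gamma(\cdot,t)$ is an immersion ($\gamma_x\neq 0$), is periodic in $x$ with some fixed period, and is injective modulo that period. The arc-length derivative at time $t$ is $\frac{\partial}{\partial s}=\frac{1}{|\gamma_x|}\frac{\partial}{\partial x}$, and the time derivative $\frac{\partial}{\partial t}$ is taken with $x$ held fixed (so $\partial_t$ and $\partial_s$ do not commute: $\partial_t\partial_s=\partial_s\partial_t+\kappa^2\partial_s$). The unit tangent is $\mathbf{T}=\gamma_s$, $\mathbf{N}$ is a continuous choice of unit normal, and the curvature $\kappa$ is defined by $\mathbf{T}_s=\kappa\mathbf{N}$, $\mathbf{N}_s=-\kappa\mathbf{T}$. The curve shortening flow is $\frac{\partial\gamma}{\partial t}=\kappa\mathbf{N}$ with initial condition $\gamma(\cdot,0)=\gamma_0$. Functions written as functions of $(s,t)$ are functions on the evolving curve, and subscripts $s$, $t$ denote the derivatives $\partial_s$,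 $\partial_t$ above. Convexity of the initial curve means $\kappa>0$ at time $t=0$ (with $\mathbf{N}$ the inward normal). Under the flow $\kappa_t=\kappa_{ss}+\kappa^3$, and it is known that $\kappa>0$ then holds for all $t\in[0,T)$. *)

theory Defs
  imports "HOL-Analysis.Analysis"
begin

(* C^k on a set that need not be open.  Derivatives are Frechet derivatives within S, hence
   one-sided at boundary points; they are unique on S = UNIV \<times> {0..<T}, the only use below. *)
primrec ck_on :: "nat \<Rightarrow> 'a::real_normed_vector set \<Rightarrow> ('a \<Rightarrow> 'b::real_normed_vector) \<Rightarrow> bool" where
  "ck_on 0 S f \<longleftrightarrow> continuous_on S f"
| "ck_on (Suc k) S f \<longleftrightarrow>
     (\<exists>f'. (\<forall>p\<in>S. (f has_derivative f' p) (at p within S)) \<and> (\<forall>v. ck_on k S (\<lambda>p. f' p v)))"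

definition smooth_on :: "'a::real_normed_vector set \<Rightarrow> ('a \<Rightarrow> 'b::real_normed_vector) \<Rightarrow> bool" where
  "smooth_on S f \<longleftrightarrow> (\<forall>k. ck_on k S f)"

definition x_deriv :: "(real \<times> real \<Rightarrow> 'b::real_normed_vector) \<Rightarrow> real \<times> real \<Rightarrow> 'b" where
  "x_deriv f = (\<lambda>(x, t). vector_derivative (\<lambda>y. f (y, t)) (at x))"

(* x is held fixed; one-sided at t = 0 *)
definition time_deriv :: "real \<Rightarrow> (real \<times> real \<Rightarrow> 'b::real_normed_vector) \<Rightarrow> real \<times> real \<Rightarrow> 'b" where
  "time_deriv T f = (\<lambda>(x, t). vector_derivative (\<lambda>\<tau>. f (x, \<tau>)) (at t within {0..<T}))"

definition arc_deriv ::
    "(real \<times> real \<Rightarrow> real ^ 2) \<Rightarrow> (real \<times> real \<Rightarrow> 'b::real_normed_vector) \<Rightarrow> real \<times> real \<Rightarrow> 'b" where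
  "arc_deriv \<gamma> f p = (1 / norm (x_deriv \<gamma> p)) *\<^sub>R x_deriv f p"

definition unit_tangent :: "(real \<times> real \<Rightarrow> real ^ 2) \<Rightarrow> real \<times> real \<Rightarrow> real ^ 2" where
  "unit_tangent \<gamma> = arc_deriv \<gamma> \<gamma>"

(* one period L serves for all times *)
definition closed_embedded_family :: "real \<Rightarrow> (real \<times> real \<Rightarrow> real ^ 2) \<Rightarrow> bool" where
  "closed_embedded_family T \<gamma> \<longleftrightarrow>
     smooth_on (UNIV \<times> {0..<T}) \<gamma> \<and>
     (\<forall>x. \<forall>t\<in>{0..<T}. x_deriv \<gamma> (x, t) \<noteq> 0) \<and>
     (\<exists>L>0. \<forall>t\<in>{0..<T}.
        (\<forall>x. \<gamma> (x + L, t) = \<gamma> (x, t)) \<and>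
        (\<forall>x y. \<gamma> (x, t) = \<gamma> (y, t) \<longrightarrow> (\<exists>n::int. y = x + of_int n * L)))"

definition unit_normal_field ::
    "real \<Rightarrow> (real \<times> real \<Rightarrow> real ^ 2) \<Rightarrow> (real \<times> real \<Rightarrow> real ^ 2) \<Rightarrow> bool" where
  "unit_normal_field T \<gamma> N \<longleftrightarrow>
     continuous_on (UNIV \<times> {0..<T}) N \<and>
     (\<forall>p \<in> UNIV \<times> {0..<T}. norm (N p) = 1 \<and> N p \<bullet> unit_tangent \<gamma> p = 0)"

definition is_curvature ::
    "real \<Rightarrow> (real \<times> real \<Rightarrow> real ^ 2) \<Rightarrow> (real \<times> real \<Rightarrow> real ^ 2) \<Rightarrow> (real \<times> real \<Rightarrow> real) \<Rightarrow> bool" where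
  "is_curvature T \<gamma> N \<kappa> \<longleftrightarrow>
     (\<forall>p \<in> UNIV \<times> {0..<T}.
        arc_deriv \<gamma> (unit_tangent \<gamma>) p = \<kappa> p *\<^sub>R N p \<and>
        arc_deriv \<gamma> N p = - \<kappa> p *\<^sub>R unit_tangent \<gamma> p)"

definition curve_shortening_flow ::
    "real \<Rightarrow> (real \<times> real \<Rightarrow> real ^ 2) \<Rightarrow> (real \<times> real \<Rightarrow> real ^ 2) \<Rightarrow> (real \<times> real \<Rightarrow> real) \<Rightarrow> bool" where
  "curve_shortening_flow T \<gamma> N \<kappa> \<longleftrightarrow>
     (\<forall>p \<in> UNIV \<times> {0..<T}. time_deriv T \<gamma> p = \<kappa> p *\<^sub>R N p)"

end

theory Submission
  imports Defs
begin

text \<open>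
  Put \<open>w = \<kappa>\<^sub>s / \<kappa>\<close> and \<open>Z = w\<^sub>s + \<kappa>\<^sup>2\<close>. The evolution equation \<open>\<kappa>\<^sub>t = \<kappa>\<^sub>s\<^sub>s + \<kappa>\<^sup>3\<close> becomes
  \<open>\<kappa>\<^sub>t = \<kappa> (Z + w\<^sup>2)\<close>, so the claim says \<open>Z \<ge> - 1 / (2 t)\<close>. The commutator rule for \<open>\<partial>\<^sub>t\<close> and \<open>\<partial>\<^sub>s\<close>
  gives \<open>Z\<^sub>t = Z\<^sub>s\<^sub>s + 2 w Z\<^sub>s + 2 Z\<^sup>2\<close>. At a minimum of \<open>t Z\<close> over a slab \<open>0 \<le> t \<le> b\<close> with value below \<open>- 1 / 2\<close>
  one has \<open>t > 0\<close>, \<open>Z < 0\<close> and \<open>(t Z)\<^sub>t \<ge> Z (1 + 2 t Z) > 0\<close>, which is impossible at a minimum.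
\<close>

section \<open>Smooth functions on a set\<close>

text \<open>Derivatives within \<open>S\<close> see only values on \<open>S\<close>. This matters
  because the normal and the curvature are unconstrained off the strip.\<close>

lemma ck_on_cong:
  assumes "ck_on k S f" "\<And>p. p \<in> S \<Longrightarrow> f p = g p"
  shows "ck_on k S g"
proof (cases k)
  case 0
  then show ?thesis
    using assms continuous_on_cong by force
next
  case (Suc j)
  then obtain f' where f': "\<forall>p\<in>S. (f has_derivative f' p) (at p within S)"
      "\<forall>v. ck_on j S (\<lambda>p. f' p v)"
    using assms(1) by auto
  have "\<forall>p\<in>S. (g has_derivative f' p) (at p within S)"
    using f'(1) assms(2) by (metis has_derivative_transform)
  then show ?thesis
    using f'(2) Suc by auto
qed

lemma ck_on_SucD:
  assumes "ck_on (Suc k) S f"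
  shows "ck_on k S f"
  using assms
proof (induction k arbitrary: f)
  case 0
  then show ?case
    by (auto intro: has_derivative_continuous_on)
next
  case (Suc k)
  then obtain f' where "\<forall>p\<in>S. (f has_derivative f' p) (at p within S)"
      "\<forall>v. ck_on (Suc k) S (\<lambda>p. f' p v)"
    by (subst (asm) ck_on.simps(2)) blast
  with Suc.IH show ?case
    unfolding ck_on.simps(2) by blast
qed

lemma ck_on_const: "ck_on k S (\<lambda>p. c)"
proof (induction k arbitrary: c)
  case (Suc k)
  show ?case
    unfolding ck_on.simps by (rule exI[of _ "\<lambda>p v. 0"]) (auto intro: Suc)
qed auto

lemma ck_on_add:
  assumes "ck_on k S f" "ck_on k S g"
  shows "ck_on k S (\<lambda>p. f p + g p)"
  using assms
proof (induction k arbitrary: f g)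
  case (Suc k)
  obtain f' where f': "\<And>p. p \<in> S \<Longrightarrow> (f has_derivative f' p) (at p within S)"
      "\<And>v. ck_on k S (\<lambda>p. f' p v)"
    using Suc.prems(1) by auto
  obtain g' where g': "\<And>p. p \<in> S \<Longrightarrow> (g has_derivative g' p) (at p within S)"
      "\<And>v. ck_on k S (\<lambda>p. g' p v)"
    using Suc.prems(2) by auto
  show ?case
    unfolding ck_on.simps
    by (rule exI[of _ "\<lambda>p v. f' p v + g' p v"])
      (auto intro!: Suc.IH has_derivative_add f' g')
qed (auto intro: continuous_on_add)

lemma ck_on_bounded_linear:
  assumes "bounded_linear h" "ck_on k S f"
  shows "ck_on k S (\<lambda>p. h (f p))"
  using assms(2)
proof (induction k arbitrary: f)
  case 0
  then show ?case
    by (auto intro: bounded_linear.continuous_on[OF assms(1)])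
next
  case (Suc k)
  obtain f' where f': "\<And>p. p \<in> S \<Longrightarrow> (f has_derivative f' p) (at p within S)"
      "\<And>v. ck_on k S (\<lambda>p. f' p v)"
    using Suc.prems(1) by auto
  show ?case
    unfolding ck_on.simps
    by (rule exI[of _ "\<lambda>p v. h (f' p v)"])
      (auto intro!: Suc.IH bounded_linear.has_derivative[OF assms(1)] f')
qed

text \<open>In the product rule each summand pairs one function with a derivative of the other, so
  the induction uses both factors at the lower order as well. One statement serves products, scalar
  multiples and inner products.\<close>

lemma ck_on_bounded_bilinear:
  assumes "bounded_bilinear h" "ck_on k S f" "ck_on k S g"
  shows "ck_on k S (\<lambda>p. h (f p) (g p))"
  using assms(2,3)
proof (induction k arbitrary: f g)
  case 0
  then show ?case
    by (auto intro: bounded_bilinear.continuous_on[OF assms(1)])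
next
  case (Suc k)
  obtain f' where f': "\<And>p. p \<in> S \<Longrightarrow> (f has_derivative f' p) (at p within S)"
      "\<And>v. ck_on k S (\<lambda>p. f' p v)"
    using Suc.prems(1) by auto
  obtain g' where g': "\<And>p. p \<in> S \<Longrightarrow> (g has_derivative g' p) (at p within S)"
      "\<And>v. ck_on k S (\<lambda>p. g' p v)"
    using Suc.prems(2) by auto
  show ?case
    unfolding ck_on.simps
    by (rule exI[of _ "\<lambda>p v. h (f p) (g' p v) + h (f' p v) (g p)"])
      (auto intro!: ck_on_add Suc.IH bounded_bilinear.FDERIV[OF assms(1)] f' g'
        Suc.prems[THEN ck_on_SucD])
qed

text \<open>The derivative of \<open>1 / f\<close> contains \<open>1 / f\<close> again, so the
  induction hypothesis is applied to the very function whose order is being raised.\<close>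

lemma ck_on_inverse:
  fixes f :: "'a::real_normed_vector \<Rightarrow> real"
  assumes "ck_on k S f" "\<And>p. p \<in> S \<Longrightarrow> f p \<noteq> 0"
  shows "ck_on k S (\<lambda>p. inverse (f p))"
  using assms(1)
proof (induction k)
  case 0
  then show ?case
    using assms(2) by (auto intro!: continuous_on_inverse)
next
  case (Suc k)
  obtain f' where f': "\<And>p. p \<in> S \<Longrightarrow> (f has_derivative f' p) (at p within S)"
      "\<And>v. ck_on k S (\<lambda>p. f' p v)"
    using Suc.prems(1) by auto
  have inv: "ck_on k S (\<lambda>p. inverse (f p))"
    by (rule Suc.IH[OF ck_on_SucD[OF Suc.prems]])
  have "\<forall>p\<in>S. ((\<lambda>p. inverse (f p)) has_derivative
      (\<lambda>v. - (inverse (f p) * f' p v * inverse (f p)))) (at p within S)"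
    using Deriv.has_derivative_inverse[OF assms(2) f'(1)] by simp
  then show ?case
    unfolding ck_on.simps
    by (intro exI[of _ "\<lambda>p v. - (inverse (f p) * f' p v * inverse (f p))"] conjI allI f' inv
        ck_on_bounded_linear[OF bounded_linear_minus[OF bounded_linear_ident]]
        ck_on_bounded_bilinear[OF bounded_bilinear_mult])
qed

text \<open>The same bootstrapping through the derivative \<open>f' / (2 * sqrt f)\<close>;
  positivity allows the division.\<close>

lemma ck_on_sqrt:
  fixes f :: "'a::real_normed_vector \<Rightarrow> real"
  assumes "ck_on k S f" "\<And>p. p \<in> S \<Longrightarrow> f p > 0"
  shows "ck_on k S (\<lambda>p. sqrt (f p))"
  using assms(1)
proof (induction k)
  case 0
  then show ?case
    by (auto intro!: continuous_on_real_sqrt)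
next
  case (Suc k)
  obtain f' where f': "\<And>p. p \<in> S \<Longrightarrow> (f has_derivative f' p) (at p within S)"
      "\<And>v. ck_on k S (\<lambda>p. f' p v)"
    using Suc.prems(1) by auto
  have inv: "ck_on k S (\<lambda>p. inverse (sqrt (f p)))"
    using assms(2) by (intro ck_on_inverse Suc.IH[OF ck_on_SucD[OF Suc.prems]]) force
  have "\<forall>p\<in>S. ((\<lambda>p. sqrt (f p)) has_derivative (\<lambda>v. f' p v * (inverse (sqrt (f p)) * (1/2))))
      (at p within S)"
    using has_derivative_real_sqrt[OF assms(2) f'(1)]
    by (auto simp: divide_simps field_simps elim!: has_derivative_eq_rhs)
  then show ?case
    unfolding ck_on.simps
    by (intro exI[of _ "\<lambda>p v. f' p v * (inverse (sqrt (f p)) * (1/2))"] conjI allI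
        ck_on_bounded_bilinear[OF bounded_bilinear_mult] f' inv ck_on_const)
qed

section \<open>Closure properties of smooth functions\<close>

lemma smooth_on_cong:
  assumes "smooth_on S f" "\<And>p. p \<in> S \<Longrightarrow> f p = g p"
  shows "smooth_on S g"
  using assms ck_on_cong unfolding smooth_on_def by blast

lemma smooth_on_const: "smooth_on S (\<lambda>p. c)"
  by (simp add: smooth_on_def ck_on_const)

lemma smooth_on_add: "smooth_on S f \<Longrightarrow> smooth_on S g \<Longrightarrow> smooth_on S (\<lambda>p. f p + g p)"
  by (simp add: smooth_on_def ck_on_add)

lemma smooth_on_bounded_linear:
  "bounded_linear h \<Longrightarrow> smooth_on S f \<Longrightarrow> smooth_on S (\<lambda>p. h (f p))"
  by (simp add: smooth_on_def ck_on_bounded_linear)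

lemma smooth_on_bounded_bilinear:
  "bounded_bilinear h \<Longrightarrow> smooth_on S f \<Longrightarrow> smooth_on S g \<Longrightarrow> smooth_on S (\<lambda>p. h (f p) (g p))"
  by (simp add: smooth_on_def ck_on_bounded_bilinear)

lemmas smooth_on_mult = smooth_on_bounded_bilinear[OF bounded_bilinear_mult]
lemmas smooth_on_scaleR = smooth_on_bounded_bilinear[OF bounded_bilinear_scaleR]
lemmas smooth_on_inner = smooth_on_bounded_bilinear[OF bounded_bilinear_inner]

lemma smooth_on_inverse:
  fixes f :: "'a::real_normed_vector \<Rightarrow> real"
  shows "smooth_on S f \<Longrightarrow> (\<And>p. p \<in> S \<Longrightarrow> f p \<noteq> 0) \<Longrightarrow> smooth_on S (\<lambda>p. inverse (f p))"
  by (simp add: smooth_on_def ck_on_inverse)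

lemma smooth_on_divide:
  fixes f g :: "'a::real_normed_vector \<Rightarrow> real"
  shows "smooth_on S f \<Longrightarrow> smooth_on S g \<Longrightarrow> (\<And>p. p \<in> S \<Longrightarrow> g p \<noteq> 0) \<Longrightarrow>
    smooth_on S (\<lambda>p. f p / g p)"
  unfolding divide_inverse by (intro smooth_on_mult smooth_on_inverse)

lemma smooth_on_sqrt:
  fixes f :: "'a::real_normed_vector \<Rightarrow> real"
  shows "smooth_on S f \<Longrightarrow> (\<And>p. p \<in> S \<Longrightarrow> f p > 0) \<Longrightarrow> smooth_on S (\<lambda>p. sqrt (f p))"
  by (simp add: smooth_on_def ck_on_sqrt)

lemma smooth_on_norm:
  fixes f :: "'a::real_normed_vector \<Rightarrow> 'b::real_inner"
  assumes "smooth_on S f" "\<And>p. p \<in> S \<Longrightarrow> f p \<noteq> 0"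
  shows "smooth_on S (\<lambda>p. norm (f p))"
  unfolding norm_eq_sqrt_inner using assms by (intro smooth_on_sqrt smooth_on_inner) auto

lemma smooth_on_imp_continuous_on: "smooth_on S f \<Longrightarrow> continuous_on S f"
  unfolding smooth_on_def by (metis ck_on.simps(1))

lemma smooth_on_imp_has_derivative:
  assumes "smooth_on S f" "p \<in> S"
  obtains f' where "(f has_derivative f') (at p within S)"
  using assms unfolding smooth_on_def by (metis ck_on.simps(2))

section \<open>Partial derivatives on a strip\<close>

abbreviation strip :: "real \<Rightarrow> (real \<times> real) set" where
  "strip T \<equiv> UNIV \<times> {0..<T}"

text \<open>Chain rule with the affine embeddings of the two coordinate lines; their images stay in
  the strip, so one-sidedness at \<open>t = 0\<close> is inherited.\<close>

lemma has_vector_derivative_slices: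
  assumes "(f has_derivative f') (at (x, t) within strip T)" "t \<in> {0..<T}"
  shows "((\<lambda>y. f (y, t)) has_vector_derivative f' (1, 0)) (at x)"
    and "((\<lambda>\<tau>. f (x, \<tau>)) has_vector_derivative f' (0, 1)) (at t within {0..<T})"
proof -
  have lin: "f' (c *\<^sub>R v) = c *\<^sub>R f' v" for c v
    using linear_scale[OF has_derivative_linear[OF assms(1)]] .
  have sub: "(\<lambda>y. (y, t)) ` UNIV \<subseteq> strip T" "(\<lambda>\<tau>. (x, \<tau>)) ` {0..<T} \<subseteq> strip T"
    using assms(2) by auto
  have "((\<lambda>y. (y, t)) has_derivative (\<lambda>h. (h, 0))) (at x within UNIV)"
    by (intro has_derivative_Pair has_derivative_ident has_derivative_const)
  then have "((\<lambda>y. f (y, t)) has_derivative (\<lambda>h. f' (h, 0))) (at x within UNIV)"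
    by (rule has_derivative_in_compose) (rule has_derivative_subset[OF assms(1) sub(1)])
  moreover have "(\<lambda>h. f' (h, 0)) = (\<lambda>h. h *\<^sub>R f' (1, 0))"
    unfolding lin[symmetric] by simp
  ultimately show "((\<lambda>y. f (y, t)) has_vector_derivative f' (1, 0)) (at x)"
    unfolding has_vector_derivative_def by (rule has_derivative_eq_rhs)
  have "((\<lambda>\<tau>. (x, \<tau>)) has_derivative (\<lambda>h. (0, h))) (at t within {0..<T})"
    by (intro has_derivative_Pair has_derivative_ident has_derivative_const)
  then have "((\<lambda>\<tau>. f (x, \<tau>)) has_derivative (\<lambda>h. f' (0, h))) (at t within {0..<T})"
    by (rule has_derivative_in_compose) (rule has_derivative_subset[OF assms(1) sub(2)])
  moreover have "(\<lambda>h. f' (0, h)) = (\<lambda>h. h *\<^sub>R f' (0, 1))"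
    unfolding lin[symmetric] by simp
  ultimately show "((\<lambda>\<tau>. f (x, \<tau>)) has_vector_derivative f' (0, 1)) (at t within {0..<T})"
    unfolding has_vector_derivative_def by (rule has_derivative_eq_rhs)
qed

text \<open>A connected set with more than one point has no isolated points. Nontriviality of the
  filter makes the time derivative unique, also at \<open>t = 0\<close>.\<close>

lemma at_within_Ico_neq_bot:
  fixes t :: real
  assumes "t \<in> {a..<b}"
  shows "at t within {a..<b} \<noteq> bot"
proof -
  have "(t + b) / 2 \<in> {a..<b}" "(t + b) / 2 \<noteq> t"
    using assms by auto
  then have "{a..<b} \<noteq> {x}" for x
    using assms by (metis singletonD)
  then have "t islimpt {a..<b}"
    by (rule connected_imp_perfect[OF connected_Ico assms])
  then show ?thesis
    by (simp add: trivial_limit_within)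
qed

lemma time_deriv_eqI:
  assumes "((\<lambda>\<tau>. f (x, \<tau>)) has_vector_derivative D) (at t within {0..<T})" "t \<in> {0..<T}"
  shows "time_deriv T f (x, t) = D"
  using assms at_within_Ico_neq_bot
  by (simp add: time_deriv_def vector_derivative_within)

lemma x_deriv_eqI:
  assumes "((\<lambda>y. f (y, t)) has_vector_derivative D) (at x)"
  shows "x_deriv f (x, t) = D"
  using assms by (simp add: x_deriv_def vector_derivative_at)

lemma has_vector_derivative_x_deriv:
  assumes "smooth_on (strip T) f" "t \<in> {0..<T}"
  shows "((\<lambda>y. f (y, t)) has_vector_derivative x_deriv f (x, t)) (at x)"
proof -
  obtain f' where "(f has_derivative f') (at (x, t) within strip T)"
    using smooth_on_imp_has_derivative[OF assms(1)] assms(2) by blast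
  from has_vector_derivative_slices(1)[OF this assms(2)] show ?thesis
    using x_deriv_eqI by metis
qed

lemma has_vector_derivative_time_deriv:
  assumes "smooth_on (strip T) f" "t \<in> {0..<T}"
  shows "((\<lambda>\<tau>. f (x, \<tau>)) has_vector_derivative time_deriv T f (x, t)) (at t within {0..<T})"
proof -
  obtain f' where "(f has_derivative f') (at (x, t) within strip T)"
    using smooth_on_imp_has_derivative[OF assms(1)] assms(2) by blast
  from has_vector_derivative_slices(2)[OF this assms(2)] show ?thesis
    using time_deriv_eqI assms(2) by metis
qed

text \<open>\<open>ck_on\<close> controls the derivative in each fixed direction, and the directions
  \<open>(1, 0)\<close> and \<open>(0, 1)\<close> give the partial derivatives.\<close>

lemma smooth_on_partials:
  assumes "smooth_on (strip T) f"
  shows smooth_on_x_deriv: "smooth_on (strip T) (x_deriv f)"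
    and smooth_on_time_deriv: "smooth_on (strip T) (time_deriv T f)"
proof -
  have "ck_on k (strip T) (x_deriv f) \<and> ck_on k (strip T) (time_deriv T f)" for k
  proof -
    have "ck_on (Suc k) (strip T) f"
      using assms by (simp only: smooth_on_def)
    then obtain f' where f': "\<And>p. p \<in> strip T \<Longrightarrow> (f has_derivative f' p) (at p within strip T)"
        "\<And>v. ck_on k (strip T) (\<lambda>p. f' p v)"
      by auto
    have "f' p (1, 0) = x_deriv f p \<and> f' p (0, 1) = time_deriv T f p" if p: "p \<in> strip T" for p
    proof -
      obtain x t where xt: "p = (x, t)" "t \<in> {0..<T}"
        using p by auto
      show ?thesis
        using has_vector_derivative_slices[OF f'(1)[OF p, unfolded xt(1)] xt(2)] xt
        by (simp add: x_deriv_eqI time_deriv_eqI)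
    qed
    then show ?thesis
      using ck_on_cong[OF f'(2)[of "(1, 0)"], of "x_deriv f"]
        ck_on_cong[OF f'(2)[of "(0, 1)"], of "time_deriv T f"] by blast
  qed
  then show "smooth_on (strip T) (x_deriv f)" "smooth_on (strip T) (time_deriv T f)"
    by (simp_all add: smooth_on_def)
qed

section \<open>Calculus rules for the two partial derivatives\<close>

lemma x_deriv_cong:
  assumes "\<And>p. p \<in> strip T \<Longrightarrow> f p = g p" "p \<in> strip T"
  shows "x_deriv f p = x_deriv g p"
  using assms by (cases p) (simp add: x_deriv_def)

text \<open>\<open>vector_derivative\<close> chooses a value satisfying the derivative predicate, so
  it suffices that the two predicates agree; the filter never leaves \<open>{0..<T}\<close>.\<close>

lemma time_deriv_cong:
  assumes "\<And>p. p \<in> strip T \<Longrightarrow> f p = g p" "p \<in> strip T"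
  shows "time_deriv T f p = time_deriv T g p"
proof -
  obtain x t where [simp]: "p = (x, t)" by fastforce
  have "((\<lambda>\<tau>. f (x, \<tau>)) has_vector_derivative D) (at t within {0..<T}) \<longleftrightarrow>
        ((\<lambda>\<tau>. g (x, \<tau>)) has_vector_derivative D) (at t within {0..<T})" for D
    using assms by (intro has_vector_derivative_cong_ev) (auto simp: eventually_at_filter)
  then show ?thesis
    by (simp add: time_deriv_def vector_derivative_def)
qed

lemma partials_add:
  assumes "smooth_on (strip T) f" "smooth_on (strip T) g" "p \<in> strip T"
  shows x_deriv_add: "x_deriv (\<lambda>p. f p + g p) p = x_deriv f p + x_deriv g p"
    and time_deriv_add: "time_deriv T (\<lambda>p. f p + g p) p = time_deriv T f p + time_deriv T g p"
proof -
  obtain x t where p: "p = (x, t)" "t \<in> {0..<T}" using assms(3) by auto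
  show "x_deriv (\<lambda>p. f p + g p) p = x_deriv f p + x_deriv g p"
    unfolding p using p(2) assms
    by (intro x_deriv_eqI has_vector_derivative_add has_vector_derivative_x_deriv)
  show "time_deriv T (\<lambda>p. f p + g p) p = time_deriv T f p + time_deriv T g p"
    unfolding p using p(2) assms
    by (intro time_deriv_eqI has_vector_derivative_add has_vector_derivative_time_deriv)
qed

lemma partials_bounded_bilinear:
  assumes "bounded_bilinear h" "smooth_on (strip T) f" "smooth_on (strip T) g" "p \<in> strip T"
  shows x_deriv_bounded_bilinear:
      "x_deriv (\<lambda>p. h (f p) (g p)) p = h (f p) (x_deriv g p) + h (x_deriv f p) (g p)"
    and time_deriv_bounded_bilinear:
      "time_deriv T (\<lambda>p. h (f p) (g p)) p = h (f p) (time_deriv T g p) + h (time_deriv T f p) (g p)"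
proof -
  obtain x t where p: "p = (x, t)" "t \<in> {0..<T}" using assms(4) by auto
  show "x_deriv (\<lambda>p. h (f p) (g p)) p = h (f p) (x_deriv g p) + h (x_deriv f p) (g p)"
    unfolding p using p(2) assms
    by (intro x_deriv_eqI bounded_bilinear.has_vector_derivative has_vector_derivative_x_deriv)
  show "time_deriv T (\<lambda>p. h (f p) (g p)) p = h (f p) (time_deriv T g p) + h (time_deriv T f p) (g p)"
    unfolding p using p(2) assms
    by (intro time_deriv_eqI bounded_bilinear.has_vector_derivative has_vector_derivative_time_deriv)
qed

lemma continuous_on_x_slice:
  assumes "smooth_on (strip T) g" "t \<in> {0..<T}"
  shows "continuous_on A (\<lambda>y. g (y, t))"
proof -
  have cont: "continuous_on A (\<lambda>y. (y, t))"
    by (intro continuous_on_Pair continuous_on_id continuous_on_const)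
  have "(\<lambda>y. (y, t)) ` A \<subseteq> strip T"
    using assms(2) by auto
  then show ?thesis
    by (rule continuous_on_compose2[OF smooth_on_imp_continuous_on[OF assms(1)] cont])
qed

lemma time_deriv_x_deriv_commute:
  fixes f :: "real \<times> real \<Rightarrow> 'b::euclidean_space"
  assumes f: "smooth_on (strip T) f" and p: "p \<in> strip T"
  shows "time_deriv T (x_deriv f) p = x_deriv (time_deriv T f) p"
proof -
  obtain x0 t0 where p: "p = (x0, t0)" "t0 \<in> {0..<T}" using p by auto
  \<comment> \<open>Differentiating the fundamental theorem of calculus for \<open>x_deriv f\<close> under the integral sign
    works up to the boundary \<open>t = 0\<close>, unlike the usual mean value argument.\<close>
  define a b where "a = x0 - 1" and "b = x0 + 1"
  note fx = smooth_on_x_deriv[OF f] and fxt = smooth_on_time_deriv[OF smooth_on_x_deriv[OF f]]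
  have int: "integral (cbox a x) (\<lambda>y. x_deriv f (y, t)) = f (x, t) - f (a, t)"
    if "x \<in> {a..b}" "t \<in> {0..<T}" for x t
  proof -
    have "((\<lambda>y. x_deriv f (y, t)) has_integral f (x, t) - f (a, t)) {a..x}"
      using that by (intro fundamental_theorem_of_calculus
          has_vector_derivative_at_within[OF has_vector_derivative_x_deriv[OF f]]) auto
    then show ?thesis
      by (simp add: integral_unique)
  qed
  have ft: "time_deriv T f (x, t0) =
      time_deriv T f (a, t0) + integral {a..x} (\<lambda>y. time_deriv T (x_deriv f) (y, t0))"
    if x: "x \<in> {a..b}" for x
  proof -
    have "((\<lambda>t. integral (cbox a x) (\<lambda>y. x_deriv f (y, t))) has_vector_derivative
        integral (cbox a x) (\<lambda>y. time_deriv T (x_deriv f) (y, t0))) (at t0 within {0..<T})"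
    proof (rule leibniz_rule_vector_derivative)
      show "((\<lambda>t. x_deriv f (y, t)) has_vector_derivative time_deriv T (x_deriv f) (y, t))
          (at t within {0..<T})" if "t \<in> {0..<T}" for t y
        using has_vector_derivative_time_deriv[OF fx that] .
      show "(\<lambda>y. x_deriv f (y, t)) integrable_on cbox a x" if "t \<in> {0..<T}" for t
        by (rule integrable_continuous[OF continuous_on_x_slice[OF fx that]])
      show "continuous_on ({0..<T} \<times> cbox a x) (\<lambda>(t, y). time_deriv T (x_deriv f) (y, t))"
      proof -
        have cont: "continuous_on ({0..<T} \<times> cbox a x) (\<lambda>z. (snd z, fst z))"
          by (intro continuous_on_Pair continuous_on_snd continuous_on_fst continuous_on_id)
        have "(\<lambda>z. (snd z, fst z)) ` ({0..<T} \<times> cbox a x) \<subseteq> strip T"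
          by auto
        then show ?thesis
          unfolding split_beta
          by (rule continuous_on_compose2[OF smooth_on_imp_continuous_on[OF fxt] cont])
      qed
    qed (use p in auto)
    then have "((\<lambda>t. f (x, t) - f (a, t)) has_vector_derivative
        integral (cbox a x) (\<lambda>y. time_deriv T (x_deriv f) (y, t0))) (at t0 within {0..<T})"
      by (rule has_vector_derivative_transform[rotated 2]) (use p int[OF x] in auto)
    moreover have "((\<lambda>t. f (x, t) - f (a, t)) has_vector_derivative
        time_deriv T f (x, t0) - time_deriv T f (a, t0)) (at t0 within {0..<T})"
      using p(2) f by (intro has_vector_derivative_diff has_vector_derivative_time_deriv)
    ultimately have "integral (cbox a x) (\<lambda>y. time_deriv T (x_deriv f) (y, t0)) =
        time_deriv T f (x, t0) - time_deriv T f (a, t0)"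
      by (rule vector_derivative_unique_within[OF at_within_Ico_neq_bot[OF p(2)]])
    then show ?thesis
      by simp
  qed
  \<comment> \<open>The right side of \<open>ft\<close> is, up to a constant, an indefinite integral
    of a continuous function, so its derivative at \<open>x0\<close> is the integrand there.\<close>
  have "((\<lambda>x. integral {a..x} (\<lambda>y. time_deriv T (x_deriv f) (y, t0))) has_vector_derivative
      time_deriv T (x_deriv f) (x0, t0)) (at x0 within {a..b})"
    using continuous_on_x_slice[OF fxt p(2)]
    by (intro integral_has_vector_derivative) (auto simp: a_def b_def)
  from has_vector_derivative_add[OF has_vector_derivative_const this]
  have deriv: "((\<lambda>x. time_deriv T f (a, t0) + integral {a..x} (\<lambda>y. time_deriv T (x_deriv f) (y, t0)))
      has_vector_derivative time_deriv T (x_deriv f) (x0, t0)) (at x0 within {a..b})"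
    by simp
  have x0: "x0 \<in> {a..b}" and at: "at x0 within {a..b} = at x0"
    by (auto simp: a_def b_def at_within_Icc_at)
  from x0 ft deriv have "((\<lambda>x. time_deriv T f (x, t0)) has_vector_derivative
      time_deriv T (x_deriv f) (x0, t0)) (at x0 within {a..b})"
    by (rule has_vector_derivative_transform)
  from x_deriv_eqI[OF this[unfolded at]] show ?thesis
    using p(1) by simp
qed

section \<open>Minima and periodicity\<close>

text \<open>\<open>v\<close> stands for the speed and \<open>g\<close> for the arc-length derivative
  of \<open>f\<close>. If \<open>c < 0\<close>, then \<open>g\<close> is negative just to the right
  of the critical point, and the mean value theorem makes \<open>f\<close> drop below its
  minimum.\<close>

lemma second_deriv_nonneg_at_min:
  fixes f g :: "real \<Rightarrow> real"
  assumes f: "\<And>y. (f has_real_derivative v y * g y) (at y)"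
    and v: "\<And>y. v y > 0"
    and g: "(g has_real_derivative c) (at x)"
    and min: "\<And>y. f x \<le> f y"
  shows "g x = 0 \<and> c \<ge> 0"
proof -
  have "v x * g x = 0"
    using DERIV_local_min[OF f[of x], of 1] min by simp
  then have gx: "g x = 0"
    using v[of x] by simp
  have "c \<ge> 0"
  proof (rule ccontr)
    assume "\<not> c \<ge> 0"
    then obtain d where d: "d > 0" "\<And>h. h > 0 \<Longrightarrow> h < d \<Longrightarrow> g (x + h) < g x"
      using DERIV_neg_dec_right[OF g] by auto
    obtain z where z: "x < z" "z < x + d / 2" "f (x + d / 2) - f x = (d / 2) * (v z * g z)"
      using MVT2[of x "x + d / 2" f "\<lambda>y. v y * g y"] f d(1) by auto
    have "g z < 0"
      using d(2)[of "z - x"] z d(1) gx by auto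
    then have "(d / 2) * (v z * g z) < 0"
      using v[of z] d(1) by (simp add: mult_pos_neg)
    then show False
      using z(3) min[of "x + d / 2"] by simp
  qed
  with gx show ?thesis by simp
qed

text \<open>A minimum over a slab may lie at its final time, so only earlier times are compared; a
  positive derivative would make slightly earlier values smaller.\<close>

lemma deriv_nonpos_at_left_min:
  fixes f :: "real \<Rightarrow> real"
  assumes f: "(f has_vector_derivative c) (at t within {0..<T})"
    and t: "0 < t" "t < T"
    and min: "\<And>\<tau>. 0 \<le> \<tau> \<Longrightarrow> \<tau> \<le> t \<Longrightarrow> f t \<le> f \<tau>"
  shows "c \<le> 0"
proof (rule ccontr)
  assume "\<not> c \<le> 0"
  moreover have "at t within {0..<T} = at t"
    using t by (intro at_within_interior) (simp add: interior_atLeastLessThan)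
  then have "(f has_real_derivative c) (at t)"
    using f by (simp add: has_real_derivative_iff_has_vector_derivative)
  ultimately obtain d where d: "d > 0" "\<And>h. h > 0 \<Longrightarrow> h < d \<Longrightarrow> f (t - h) < f t"
    using DERIV_pos_inc_left by (metis not_le)
  \<comment> \<open>The cap by \<open>t\<close> keeps the earlier time \<open>t - h\<close>
    nonnegative.\<close>
  define h where "h = min (d / 2) t"
  have "h > 0" "h < d" "h \<le> t"
    using d(1) t by (auto simp: h_def)
  then show False
    using d(2)[of h] min[of "t - h"] by simp
qed

text \<open>The slab is unbounded in \<open>x\<close>, but one period times \<open>{0..b}\<close> is
  compact and \<open>f\<close> takes all its slab values there.\<close>

lemma periodic_attains_inf:
  fixes f :: "real \<times> real \<Rightarrow> real"
  assumes cont: "continuous_on (UNIV \<times> {0..b}) f" and "b \<ge> 0" "L > 0"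
    and per: "\<And>x t. t \<in> {0..b} \<Longrightarrow> f (x + L, t) = f (x, t)"
  obtains x t where "t \<in> {0..b}" "\<And>y \<tau>. \<tau> \<in> {0..b} \<Longrightarrow> f (x, t) \<le> f (y, \<tau>)"
proof -
  have "compact ({0..L} \<times> {0..b})" "{0..L} \<times> {0..b} \<noteq> {}"
    using assms(2,3) by (auto intro: compact_Times)
  moreover have "continuous_on ({0..L} \<times> {0..b}) f"
    using cont by (rule continuous_on_subset) auto
  ultimately obtain p where p: "p \<in> {0..L} \<times> {0..b}" "\<And>q. q \<in> {0..L} \<times> {0..b} \<Longrightarrow> f p \<le> f q"
    using continuous_attains_inf by metis
  have shift_nat: "f (x + real n * L, t) = f (x, t)" if "t \<in> {0..b}" for x t n
  proof (induction n)
    case (Suc n)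
    then show ?case
      using per[OF that, of "x + real n * L"] by (simp add: algebra_simps)
  qed simp
  have shift: "f (x + of_int n * L, t) = f (x, t)" if "t \<in> {0..b}" for x t n
  proof (cases "n \<ge> 0")
    case True
    then show ?thesis
      using shift_nat[OF that, of x "nat n"] by simp
  next
    case False
    then show ?thesis
      using shift_nat[OF that, of "x + of_int n * L" "nat (- n)"] by simp
  qed
  show thesis
  proof (rule that[of "snd p" "fst p"])
    show "snd p \<in> {0..b}" using p(1) by auto
    fix y \<tau> assume \<tau>: "\<tau> \<in> {0..b}"
    \<comment> \<open>Removing this many periods from \<open>y\<close> lands in
      \<open>{0..L}\<close>.\<close>
    define n where "n = \<lfloor>y / L\<rfloor>"
    have "of_int n \<le> y / L" "y / L \<le> of_int n + 1"
      unfolding n_def by linarith+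
    then have "0 \<le> y + of_int (- n) * L" "y + of_int (- n) * L \<le> L"
      using \<open>L > 0\<close> by (simp_all add: field_simps)
    then have "f p \<le> f (y + of_int (- n) * L, \<tau>)"
      using \<tau> by (intro p(2)) auto
    then show "f (fst p, snd p) \<le> f (y, \<tau>)"
      using shift[OF \<tau>, of y "- n"] by simp
  qed
qed

lemma x_deriv_periodic:
  assumes "smooth_on (strip T) f" "t \<in> {0..<T}" and per: "\<And>x. f (x + L, t) = f (x, t)"
  shows "x_deriv f (x + L, t) = x_deriv f (x, t)"
proof -
  have "((\<lambda>y. f (y, t)) has_vector_derivative x_deriv f (x + L, t)) (at (x + L))"
    using assms(1,2) by (rule has_vector_derivative_x_deriv)
  then have "(((\<lambda>y. f (y, t)) \<circ> (\<lambda>y. y + L)) has_vector_derivative 1 *\<^sub>R x_deriv f (x + L, t)) (at x)"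
    by (intro vector_diff_chain_at) (auto intro!: derivative_eq_intros)
  then have "((\<lambda>y. f (y, t)) has_vector_derivative x_deriv f (x + L, t)) (at x)"
    by (simp add: o_def per)
  from x_deriv_eqI[OF this] show ?thesis by simp
qed

section \<open>The quarter turn of the plane, linking unit normal and unit tangent\<close>

definition rot90 :: "real ^ 2 \<Rightarrow> real ^ 2" where
  "rot90 u = (\<chi> i. if i = 1 then - u $ 2 else u $ 1)"

lemma bounded_linear_rot90: "bounded_linear rot90"
  unfolding linear_conv_bounded_linear[symmetric]
  by (rule linearI) (auto simp: rot90_def vec_eq_iff)

text \<open>In the plane, the orthogonal complement of a unit vector is the line spanned by its
  quarter turn.\<close>

lemma orthonormal_eq_rot90:
  fixes u n :: "real ^ 2"
  assumes "norm u = 1" "norm n = 1" "n \<bullet> u = 0"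
  shows "n = (n \<bullet> rot90 u) *\<^sub>R rot90 u \<and> (n \<bullet> rot90 u)\<^sup>2 = 1"
proof -
  have [simp]: "(2::2) \<noteq> 1" by simp
  have u: "u $ 1 * u $ 1 + u $ 2 * u $ 2 = 1" and n: "n $ 1 * n $ 1 + n $ 2 * n $ 2 = 1"
    and nu: "n $ 1 * u $ 1 + n $ 2 * u $ 2 = 0"
    using assms by (simp_all add: norm_eq_1 inner_vec_def sum_2)
  \<comment> \<open>The factor in parentheses is \<open>n \<bullet> rot90 u\<close> in
    coordinates.\<close>
  have "n $ 1 = (n $ 2 * u $ 1 - n $ 1 * u $ 2) * - u $ 2"
    "n $ 2 = (n $ 2 * u $ 1 - n $ 1 * u $ 2) * u $ 1"
    "(n $ 2 * u $ 1 - n $ 1 * u $ 2)\<^sup>2 = 1"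
    using u n nu by algebra+
  then show ?thesis
    by (simp add: vec_eq_iff forall_2 rot90_def inner_vec_def sum_2 algebra_simps)
qed

section \<open>Evolution equations\<close>

locale convex_csf =
  fixes T :: real
    and \<gamma> N :: "real \<times> real \<Rightarrow> real ^ 2"
    and \<kappa> :: "real \<times> real \<Rightarrow> real"
  assumes family: "closed_embedded_family T \<gamma>"
    and normal: "unit_normal_field T \<gamma> N"
    and curvature: "is_curvature T \<gamma> N \<kappa>"
    and flow: "curve_shortening_flow T \<gamma> N \<kappa>"
    and initially_convex: "\<And>x. \<kappa> (x, 0) > 0"
begin

abbreviation S where "S \<equiv> strip T"
abbreviation \<tau> where "\<tau> \<equiv> unit_tangent \<gamma>"
abbreviation v where "v p \<equiv> norm (x_deriv \<gamma> p)"
abbreviation Ds :: "(real \<times> real \<Rightarrow> 'b::real_normed_vector) \<Rightarrow> real \<times> real \<Rightarrow> 'b"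
  where "Ds \<equiv> arc_deriv \<gamma>"
abbreviation Dt :: "(real \<times> real \<Rightarrow> 'b::real_normed_vector) \<Rightarrow> real \<times> real \<Rightarrow> 'b"
  where "Dt \<equiv> time_deriv T"

lemma smooth_gamma: "smooth_on S \<gamma>"
  using family by (simp add: closed_embedded_family_def)

lemma v_pos: "p \<in> S \<Longrightarrow> v p > 0"
  using family by (auto simp: closed_embedded_family_def)

lemma smooth_v: "smooth_on S v"
  using v_pos by (intro smooth_on_norm smooth_on_x_deriv smooth_gamma) force

lemma smooth_Ds:
  assumes "smooth_on S f"
  shows "smooth_on S (Ds f)"
proof -
  have "smooth_on S (\<lambda>p. (1 / v p) *\<^sub>R x_deriv f p)"
    using v_pos assms
    by (intro smooth_on_scaleR smooth_on_divide smooth_on_const smooth_v smooth_on_x_deriv) force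
  then show ?thesis
    by (simp add: arc_deriv_def[abs_def])
qed

section \<open>Calculus rules for the arc-length derivative\<close>

lemma x_deriv_eq_Ds: "p \<in> S \<Longrightarrow> x_deriv f p = v p *\<^sub>R Ds f p"
  using v_pos[of p] by (simp add: arc_deriv_def)

lemma Ds_cong: "(\<And>p. p \<in> S \<Longrightarrow> f p = g p) \<Longrightarrow> p \<in> S \<Longrightarrow> Ds f p = Ds g p"
  unfolding arc_deriv_def using x_deriv_cong[of T f g p] by simp

lemma Ds_add:
  "smooth_on S f \<Longrightarrow> smooth_on S g \<Longrightarrow> p \<in> S \<Longrightarrow> Ds (\<lambda>p. f p + g p) p = Ds f p + Ds g p"
  by (simp add: arc_deriv_def x_deriv_add scaleR_add_right)

lemma Ds_bounded_bilinear:
  assumes "bounded_bilinear h" "smooth_on S f" "smooth_on S g" "p \<in> S"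
  shows "Ds (\<lambda>p. h (f p) (g p)) p = h (f p) (Ds g p) + h (Ds f p) (g p)"
  by (simp add: arc_deriv_def x_deriv_bounded_bilinear[OF assms] scaleR_add_right
      bounded_bilinear.scaleR_left[OF assms(1)] bounded_bilinear.scaleR_right[OF assms(1)])

lemmas Ds_mult = Ds_bounded_bilinear[OF bounded_bilinear_mult]
lemmas Ds_scaleR = Ds_bounded_bilinear[OF bounded_bilinear_scaleR]
lemmas Dt_mult = time_deriv_bounded_bilinear[OF bounded_bilinear_mult]
lemmas Dt_scaleR = time_deriv_bounded_bilinear[OF bounded_bilinear_scaleR]
lemmas Dt_inner = time_deriv_bounded_bilinear[OF bounded_bilinear_inner]

section \<open>Tangent, normal and curvature\<close>

lemma smooth_tangent: "smooth_on S \<tau>"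
  unfolding unit_tangent_def by (rule smooth_Ds[OF smooth_gamma])

lemma norm_tangent: "p \<in> S \<Longrightarrow> norm (\<tau> p) = 1"
  using v_pos[of p] by (simp add: unit_tangent_def arc_deriv_def)

lemma norm_normal: "p \<in> S \<Longrightarrow> norm (N p) = 1"
  and normal_tangent: "p \<in> S \<Longrightarrow> N p \<bullet> \<tau> p = 0"
  using normal by (auto simp: unit_normal_field_def)

lemma Ds_tangent: "p \<in> S \<Longrightarrow> Ds \<tau> p = \<kappa> p *\<^sub>R N p"
  and Ds_normal: "p \<in> S \<Longrightarrow> Ds N p = - \<kappa> p *\<^sub>R \<tau> p"
  using curvature unfolding is_curvature_def by blast+

lemma Dt_gamma: "p \<in> S \<Longrightarrow> Dt \<gamma> p = \<kappa> p *\<^sub>R N p"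
  using flow unfolding curve_shortening_flow_def by blast

text \<open>The sign of \<open>N\<close> relative to the rotated tangent is continuous with values
  in \<open>{1, - 1}\<close> on the connected strip, hence constant. This upgrades the assumed
  continuity of \<open>N\<close> to smoothness and gives its periodicity.\<close>

lemma normal_eq_rot90: "\<exists>c. \<forall>p\<in>S. N p = c *\<^sub>R rot90 (\<tau> p)"
proof -
  let ?s = "\<lambda>p. N p \<bullet> rot90 (\<tau> p)"
  have eq: "N p = ?s p *\<^sub>R rot90 (\<tau> p)" "(?s p)\<^sup>2 = 1" if "p \<in> S" for p
    using orthonormal_eq_rot90[OF norm_tangent norm_normal normal_tangent] that by blast+
  have "connected S"
    by (intro convex_connected convex_Times) auto
  moreover have "continuous_on S ?s"
    using normal smooth_on_imp_continuous_on[OF smooth_on_bounded_linear[OF bounded_linear_rot90 smooth_tangent]]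
    by (intro continuous_on_inner) (simp_all add: unit_normal_field_def)
  moreover have "?s ` S \<subseteq> {1, - 1}"
    using eq(2) by (auto simp: power2_eq_1_iff)
  then have "finite (?s ` S)"
    by (rule finite_subset) simp
  ultimately have "?s constant_on S"
    by (rule continuous_finite_range_constant)
  then obtain c where "\<And>p. p \<in> S \<Longrightarrow> ?s p = c"
    unfolding constant_on_def by blast
  with eq(1) show ?thesis
    by metis
qed

lemma smooth_normal: "smooth_on S N"
proof -
  obtain c where c: "\<And>p. p \<in> S \<Longrightarrow> N p = c *\<^sub>R rot90 (\<tau> p)"
    using normal_eq_rot90 by blast
  have "smooth_on S (\<lambda>p. c *\<^sub>R rot90 (\<tau> p))"
    by (intro smooth_on_scaleR smooth_on_const smooth_on_bounded_linear[OF bounded_linear_rot90]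
        smooth_tangent)
  then show ?thesis
    by (rule smooth_on_cong) (simp add: c)
qed

text \<open>Expresses the curvature through smooth fields; its smoothness, periodicity and evolution
  all start from this formula.\<close>

lemma curvature_eq: "p \<in> S \<Longrightarrow> \<kappa> p = Ds \<tau> p \<bullet> N p"
  using norm_normal[of p] by (simp add: Ds_tangent norm_eq_1)

lemma smooth_curvature: "smooth_on S \<kappa>"
  by (rule smooth_on_cong[OF smooth_on_inner[OF smooth_Ds[OF smooth_tangent] smooth_normal]])
    (simp add: curvature_eq)

text \<open>Differentiate \<open>v * v\<close> as an inner product and exchange the derivatives: the
  \<open>x\<close>-derivative of the velocity \<open>\<kappa> N\<close> has tangential part
  \<open>- \<kappa>^2 v\<close>, and its normal part is orthogonal to the tangent.\<close>

lemma Dt_v: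
  assumes p: "p \<in> S"
  shows "Dt v p = - (\<kappa> p)\<^sup>2 * v p"
proof -
  note gx = smooth_on_x_deriv[OF smooth_gamma]
  have "Dt (\<lambda>p. v p * v p) p = Dt (\<lambda>p. x_deriv \<gamma> p \<bullet> x_deriv \<gamma> p) p"
    by (simp add: norm_eq_sqrt_inner)
  then have "2 * (v p * Dt v p) = 2 * (x_deriv \<gamma> p \<bullet> Dt (x_deriv \<gamma>) p)"
    by (simp add: Dt_mult[OF smooth_v smooth_v p] Dt_inner[OF gx gx p] inner_commute)
  also have "Dt (x_deriv \<gamma>) p = x_deriv (\<lambda>p. \<kappa> p *\<^sub>R N p) p"
    unfolding time_deriv_x_deriv_commute[OF smooth_gamma p]
    by (rule x_deriv_cong[OF _ p]) (simp add: Dt_gamma)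
  also have "\<dots> = v p *\<^sub>R (- (\<kappa> p)\<^sup>2 *\<^sub>R \<tau> p + Ds \<kappa> p *\<^sub>R N p)"
    by (simp add: x_deriv_eq_Ds[OF p, of "\<lambda>p. \<kappa> p *\<^sub>R N p"]
        Ds_scaleR[OF smooth_curvature smooth_normal p] Ds_normal[OF p] power2_eq_square)
  also have "x_deriv \<gamma> p = v p *\<^sub>R \<tau> p"
    unfolding unit_tangent_def by (rule x_deriv_eq_Ds[OF p])
  finally have "v p * Dt v p = v p * (- (\<kappa> p)\<^sup>2 * v p)"
    using norm_tangent[OF p] normal_tangent[OF p]
    by (simp add: norm_eq_1 inner_add_right inner_commute algebra_simps)
  then show ?thesis
    using v_pos[OF p] mult_left_cancel[of "v p" "Dt v p"] by (metis less_irrefl)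
qed

text \<open>Differentiate \<open>x_deriv f = v *\<^sub>R Ds f\<close> in time. The partial
  derivatives commute, so the only correction comes from the change of the speed.\<close>

lemma Dt_Ds:
  fixes f :: "real \<times> real \<Rightarrow> 'b::euclidean_space"
  assumes f: "smooth_on S f" and p: "p \<in> S"
  shows "Dt (Ds f) p = Ds (Dt f) p + (\<kappa> p)\<^sup>2 *\<^sub>R Ds f p"
proof -
  have "v p *\<^sub>R Ds (Dt f) p = Dt (x_deriv f) p"
    by (simp add: x_deriv_eq_Ds[OF p, of "Dt f"] time_deriv_x_deriv_commute[OF f p])
  also have "\<dots> = Dt (\<lambda>p. v p *\<^sub>R Ds f p) p"
    by (rule time_deriv_cong[OF x_deriv_eq_Ds p])
  also have "\<dots> = v p *\<^sub>R Dt (Ds f) p + Dt v p *\<^sub>R Ds f p"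
    by (rule Dt_scaleR[OF smooth_v smooth_Ds[OF f] p])
  finally have "v p *\<^sub>R Dt (Ds f) p = v p *\<^sub>R (Ds (Dt f) p + (\<kappa> p)\<^sup>2 *\<^sub>R Ds f p)"
    by (simp add: Dt_v[OF p] algebra_simps)
  then show ?thesis
    using v_pos[OF p] by simp
qed

text \<open>The commutator term cancels the tangential part of the arc-length derivative of
  \<open>\<kappa> N\<close>.\<close>

lemma Dt_tangent:
  assumes p: "p \<in> S"
  shows "Dt \<tau> p = Ds \<kappa> p *\<^sub>R N p"
proof -
  have "Dt \<tau> p = Ds (Dt \<gamma>) p + (\<kappa> p)\<^sup>2 *\<^sub>R \<tau> p"
    unfolding unit_tangent_def by (rule Dt_Ds[OF smooth_gamma p])
  also have "Ds (Dt \<gamma>) p = Ds (\<lambda>p. \<kappa> p *\<^sub>R N p) p"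
    by (rule Ds_cong[OF _ p]) (simp add: Dt_gamma)
  also have "\<dots> = - (\<kappa> p)\<^sup>2 *\<^sub>R \<tau> p + Ds \<kappa> p *\<^sub>R N p"
    by (simp add: Ds_scaleR[OF smooth_curvature smooth_normal p] Ds_normal[OF p] power2_eq_square)
  finally show ?thesis by simp
qed

text \<open>Differentiate \<open>Ds \<tau> \<bullet> N\<close> in time. Since
  \<open>Ds \<tau>\<close> is parallel to \<open>N\<close> while \<open>Dt N\<close> is orthogonal
  to it, only \<open>Dt (Ds \<tau>) \<bullet> N\<close> survives; the commutator term in it supplies
  the cube.\<close>

lemma Dt_curvature:
  assumes p: "p \<in> S"
  shows "Dt \<kappa> p = Ds (Ds \<kappa>) p + \<kappa> p ^ 3"
proof -
  have N: "N p \<bullet> N p = 1" and "N p \<bullet> Dt N p = 0"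
  proof -
    show "N p \<bullet> N p = 1"
      using norm_normal[OF p] by (simp add: norm_eq_1)
    have "Dt (\<lambda>p. N p \<bullet> N p) p = Dt (\<lambda>p. 1) p"
      by (rule time_deriv_cong[OF _ p]) (metis norm_normal norm_eq_1)
    also have "\<dots> = 0"
      using p by (cases p) (auto intro: time_deriv_eqI)
    finally show "N p \<bullet> Dt N p = 0"
      by (simp add: Dt_inner[OF smooth_normal smooth_normal p] inner_commute)
  qed
  have "Dt (Ds \<tau>) p = Ds (Dt \<tau>) p + (\<kappa> p)\<^sup>2 *\<^sub>R Ds \<tau> p"
    by (rule Dt_Ds[OF smooth_tangent p])
  also have "Ds (Dt \<tau>) p = Ds (\<lambda>p. Ds \<kappa> p *\<^sub>R N p) p"
    by (rule Ds_cong[OF _ p]) (simp add: Dt_tangent)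
  also have "\<dots> = - (Ds \<kappa> p * \<kappa> p) *\<^sub>R \<tau> p + Ds (Ds \<kappa>) p *\<^sub>R N p"
    by (simp add: Ds_scaleR[OF smooth_Ds[OF smooth_curvature] smooth_normal p] Ds_normal[OF p])
  finally have "Dt (Ds \<tau>) p \<bullet> N p = Ds (Ds \<kappa>) p + \<kappa> p ^ 3"
    using N normal_tangent[OF p]
    by (simp add: Ds_tangent[OF p] inner_add_left inner_diff_left inner_commute[of "\<tau> p"]
        power3_eq_cube power2_eq_square)
  moreover have "Dt \<kappa> p = Dt (\<lambda>p. Ds \<tau> p \<bullet> N p) p"
    by (rule time_deriv_cong[OF _ p]) (simp add: curvature_eq)
  ultimately show ?thesis
    using \<open>N p \<bullet> Dt N p = 0\<close>
    by (simp add: Dt_inner[OF smooth_Ds[OF smooth_tangent] smooth_normal p] Ds_tangent[OF p])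
qed

lemma spatial_min:
  fixes f :: "real \<times> real \<Rightarrow> real"
  assumes f: "smooth_on S f" and t: "t \<in> {0..<T}" and min: "\<And>y. f (x, t) \<le> f (y, t)"
  shows "Ds f (x, t) = 0 \<and> Ds (Ds f) (x, t) \<ge> 0"
proof -
  have "Ds f (x, t) = 0 \<and> x_deriv (Ds f) (x, t) \<ge> 0"
  proof (rule second_deriv_nonneg_at_min[where v = "\<lambda>y. v (y, t)" and f = "\<lambda>y. f (y, t)"
        and g = "\<lambda>y. Ds f (y, t)"])
    show "((\<lambda>y. f (y, t)) has_real_derivative v (y, t) * Ds f (y, t)) (at y)" for y
      using has_vector_derivative_x_deriv[OF f t, of y] x_deriv_eq_Ds[of "(y, t)" f] t
      by (simp add: has_real_derivative_iff_has_vector_derivative)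
    show "((\<lambda>y. Ds f (y, t)) has_real_derivative x_deriv (Ds f) (x, t)) (at x)"
      using has_vector_derivative_x_deriv[OF smooth_Ds[OF f] t, of x]
      by (simp add: has_real_derivative_iff_has_vector_derivative)
  qed (use v_pos t min in auto)
  then show ?thesis
    by (simp add: arc_deriv_def)
qed

section \<open>Preservation of convexity\<close>

definition periodic :: "real \<Rightarrow> (real \<times> real \<Rightarrow> 'b) \<Rightarrow> bool" where
  "periodic L f \<longleftrightarrow> (\<forall>x. \<forall>t\<in>{0..<T}. f (x + L, t) = f (x, t))"

lemma periodic_Ds:
  assumes "periodic L \<gamma>" "periodic L f" "smooth_on S f"
  shows "periodic L (Ds f)"
  unfolding periodic_def
proof (intro allI ballI)
  fix x t assume t: "t \<in> {0..<T}"
  have "x_deriv f (x + L, t) = x_deriv f (x, t)" "x_deriv \<gamma> (x + L, t) = x_deriv \<gamma> (x, t)"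
    using assms(1,2) t
    by (auto intro!: x_deriv_periodic[OF assms(3) t] x_deriv_periodic[OF smooth_gamma t]
        simp: periodic_def)
  then show "Ds f (x + L, t) = Ds f (x, t)"
    by (simp add: arc_deriv_def)
qed

text \<open>Periodicity passes from the curve to its tangent, and to the normal because
  \<open>N\<close> is a fixed multiple of the rotated tangent.\<close>

lemma periodic_curvature:
  assumes "periodic L \<gamma>"
  shows "periodic L \<kappa>"
proof -
  have tangent: "periodic L \<tau>"
    unfolding unit_tangent_def by (rule periodic_Ds[OF assms assms smooth_gamma])
  obtain c where c: "\<And>p. p \<in> S \<Longrightarrow> N p = c *\<^sub>R rot90 (\<tau> p)"
    using normal_eq_rot90 by blast
  have "\<kappa> (x + L, t) = \<kappa> (x, t)" if "t \<in> {0..<T}" for x t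
    using that tangent periodic_Ds[OF assms tangent smooth_tangent]
    by (simp add: curvature_eq c periodic_def)
  then show ?thesis
    by (simp add: periodic_def)
qed

lemma obtain_period:
  obtains L where "L > 0" "periodic L \<gamma>"
  using family unfolding closed_embedded_family_def periodic_def by blast

lemma continuous_on_slab:
  "smooth_on S f \<Longrightarrow> b < T \<Longrightarrow> continuous_on (UNIV \<times> {0..b}) f"
  by (rule continuous_on_subset[OF smooth_on_imp_continuous_on]) auto

lemma obtain_min:
  fixes f :: "real \<times> real \<Rightarrow> real"
  assumes "continuous_on (UNIV \<times> {0..b}) f" "0 \<le> b" "b < T" "periodic L f" "L > 0"
  obtains x t where "t \<in> {0..b}" "\<And>y s. s \<in> {0..b} \<Longrightarrow> f (x, t) \<le> f (y, s)"
  by (rule periodic_attains_inf[OF assms(1,2,5)]) (use assms(3,4) in \<open>auto simp: periodic_def\<close>)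

text \<open>
  With \<open>m\<close> the initial minimum of \<open>\<kappa>\<close> and \<open>\<mu> > \<kappa>\<^sup>2\<close> wherever \<open>\<kappa>\<close> is negative, the minimum of
  \<open>exp (- \<mu> t) (\<kappa> - m)\<close> cannot be negative: there \<open>\<kappa>\<^sup>3 \<le> \<kappa>\<^sub>t \<le> \<mu> (\<kappa> - m)\<close>.
\<close>

lemma curvature_pos:
  assumes b: "0 \<le> b" "b < T"
  shows "\<kappa> (x, b) > 0"
proof -
  obtain L where L: "L > 0" "periodic L \<gamma>"
    by (rule obtain_period)
  note per = periodic_curvature[OF L(2)]
  \<comment> \<open>The degenerate slab \<open>{0..0}\<close> is the initial curve.\<close>
  obtain x0 t0 where min0: "t0 \<in> {0..0}" "\<And>y s. s \<in> {0..0} \<Longrightarrow> \<kappa> (x0, t0) \<le> \<kappa> (y, s)"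
    by (rule obtain_min[OF continuous_on_slab[OF smooth_curvature] order_refl _ per L(1)])
      (use b in auto)
  define m where "m = \<kappa> (x0, t0)"
  have m: "m > 0" "\<And>y. m \<le> \<kappa> (y, 0)"
    using min0 initially_convex by (auto simp: m_def)
  obtain x1 t1 where min1: "t1 \<in> {0..b}" "\<And>y s. s \<in> {0..b} \<Longrightarrow> \<kappa> (x1, t1) \<le> \<kappa> (y, s)"
    by (rule obtain_min[OF continuous_on_slab[OF smooth_curvature b(2)] b per L(1)]) blast
  define \<mu> where "\<mu> = (\<kappa> (x1, t1))\<^sup>2 + 1"
  define f where "f = (\<lambda>p. exp (- \<mu> * snd p) * (\<kappa> p - m))"
  have "continuous_on (UNIV \<times> {0..b}) f"
    unfolding f_def by (intro continuous_intros continuous_on_slab smooth_curvature b)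
  moreover have "periodic L f"
    using per by (simp add: f_def periodic_def)
  ultimately obtain y t where t: "t \<in> {0..b}" and min: "\<And>z s. s \<in> {0..b} \<Longrightarrow> f (y, t) \<le> f (z, s)"
    by (rule obtain_min[OF _ b _ L(1)]) blast
  have nonneg: "f (y, t) \<ge> 0"
  proof (rule ccontr)
    assume "\<not> f (y, t) \<ge> 0"
    then have neg: "\<kappa> (y, t) < m"
      by (simp add: f_def not_le mult_less_0_iff)
    \<comment> \<open>A negative minimum cannot lie at time zero, where
      \<open>\<kappa> \<ge> m\<close>.\<close>
    then have t': "0 < t" "t < T" "t \<in> {0..<T}"
      using m(2)[of y] t b by (auto simp: less_le)
    \<comment> \<open>At a fixed time the exponential is a positive constant, so a spatial minimum
      of \<open>f\<close> is one of \<open>\<kappa>\<close>.\<close>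
    have "\<kappa> (y, t) \<le> \<kappa> (z, t)" for z
      using min[OF t, of z] by (simp add: f_def)
    then have "Ds (Ds \<kappa>) (y, t) \<ge> 0"
      using spatial_min[OF smooth_curvature t'(3)] by blast
    then have kt: "Dt \<kappa> (y, t) \<ge> \<kappa> (y, t) ^ 3"
      using Dt_curvature t'(3) by simp
    let ?e = "exp (- \<mu> * t)"
    have "((\<lambda>s. f (y, s)) has_vector_derivative
        ?e * (Dt \<kappa> (y, t) - 0) + ?e * - \<mu> * (\<kappa> (y, t) - m)) (at t within {0..<T})"
      unfolding f_def fst_conv snd_conv
      by (intro has_vector_derivative_mult has_vector_derivative_diff
          has_vector_derivative_time_deriv[OF smooth_curvature t'(3)] has_vector_derivative_const)
        (auto intro!: derivative_eq_intros simp: has_real_derivative_iff_has_vector_derivative[symmetric])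
    from deriv_nonpos_at_left_min[OF this t'(1,2)]
    have "?e * (Dt \<kappa> (y, t) - 0) + ?e * - \<mu> * (\<kappa> (y, t) - m) \<le> 0"
      using min t by simp
    then have "?e * (Dt \<kappa> (y, t) - \<mu> * (\<kappa> (y, t) - m)) \<le> 0"
      by (simp add: algebra_simps)
    then have "Dt \<kappa> (y, t) \<le> \<mu> * (\<kappa> (y, t) - m)"
      by (simp add: mult_le_0_iff)
    with kt have le: "\<kappa> (y, t) ^ 3 \<le> \<mu> * (\<kappa> (y, t) - m)"
      by simp
    show False
    \<comment> \<open>For positive curvature the left side of \<open>le\<close> is positive and the
      right side is not. Otherwise the curvature lies between its slab minimum and zero, so its
      square is at most \<open>\<mu>\<close>, which forces \<open>\<mu> * m \<le> 0\<close>.\<close>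
    proof (cases "\<kappa> (y, t) > 0")
      case True
      then have "\<mu> * (\<kappa> (y, t) - m) \<le> 0" "\<kappa> (y, t) ^ 3 > 0"
        using neg by (auto simp: \<mu>_def intro: mult_nonneg_nonpos)
      then show False using le by linarith
    next
      case False
      have k1: "\<kappa> (x1, t1) \<le> \<kappa> (y, t)"
        by (rule min1(2)[OF t])
      then have "(\<kappa> (y, t))\<^sup>2 \<le> (\<kappa> (x1, t1))\<^sup>2"
        using False by (simp add: abs_le_square_iff[symmetric])
      then have "(\<kappa> (y, t))\<^sup>2 \<le> \<mu>"
        by (simp add: \<mu>_def)
      then have "\<mu> * \<kappa> (y, t) \<le> \<kappa> (y, t) ^ 3"
        using False mult_right_mono_neg[of "(\<kappa> (y, t))\<^sup>2" \<mu> "\<kappa> (y, t)"]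
        by (simp add: power3_eq_cube power2_eq_square)
      with le have "\<mu> * m \<le> 0"
        by (simp add: algebra_simps)
      moreover have "\<mu> > 0"
        by (simp add: \<mu>_def add_nonneg_pos)
      ultimately show False
        using m(1) by (simp add: mult_le_0_iff)
    qed
  qed
  \<comment> \<open>At the final time this says \<open>\<kappa> \<ge> m\<close>, the initial
    minimum.\<close>
  have "f (x, b) \<ge> 0"
    using nonneg min[of b x] b by simp
  then show ?thesis
    using m(1) by (simp add: f_def zero_le_mult_iff)
qed

section \<open>The Harnack inequality\<close>

text \<open>
  \<open>w\<close> and \<open>Z\<close> are \<open>(ln \<kappa>)\<^sub>s\<close> and \<open>(ln \<kappa>)\<^sub>s\<^sub>s + \<kappa>\<^sup>2\<close>, written without the logarithm;
  both are only meaningful on the strip, where \<open>\<kappa>\<close> does not vanish.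
\<close>

definition w where "w p = Ds \<kappa> p / \<kappa> p"
definition Z where "Z p = Ds w p + \<kappa> p * \<kappa> p"

section \<open>Evolution of \<open>w\<close> and \<open>Z\<close>\<close>

lemma curvature_pos_strip: "p \<in> S \<Longrightarrow> \<kappa> p > 0"
  using curvature_pos by auto

lemma smooth_w: "smooth_on S w"
  unfolding w_def[abs_def] using curvature_pos_strip
  by (intro smooth_on_divide smooth_Ds smooth_curvature) (metis less_irrefl)

lemma smooth_Z: "smooth_on S Z"
  unfolding Z_def[abs_def]
  by (intro smooth_on_add smooth_on_mult smooth_Ds smooth_w smooth_curvature)

lemma Ds_curvature_eq: "p \<in> S \<Longrightarrow> Ds \<kappa> p = \<kappa> p * w p"
  using curvature_pos_strip[of p] by (simp add: w_def)

text \<open>The product rule for \<open>\<kappa> * w\<close> turns the diffusion term into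
  \<open>\<kappa> * (Ds w + w * w)\<close>; the cubic term completes \<open>Ds w\<close> to
  \<open>Z\<close>.\<close>

lemma Dt_curvature_eq:
  assumes p: "p \<in> S"
  shows "Dt \<kappa> p = \<kappa> p * (Z p + w p * w p)"
proof -
  have "Ds (Ds \<kappa>) p = Ds (\<lambda>p. \<kappa> p * w p) p"
    by (rule Ds_cong[OF Ds_curvature_eq p])
  also have "\<dots> = \<kappa> p * Ds w p + \<kappa> p * w p * w p"
    by (simp add: Ds_mult[OF smooth_curvature smooth_w p] Ds_curvature_eq[OF p])
  finally show ?thesis
    by (simp add: Dt_curvature[OF p] Z_def power3_eq_cube algebra_simps)
qed

text \<open>Compute the time derivative of \<open>Ds \<kappa> = \<kappa> * w\<close> by the product
  rule and by the commutator rule. The terms with \<open>Z + w * w\<close> as a factor cancel, and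
  \<open>\<kappa>\<close> divides out.\<close>

lemma Dt_w:
  assumes p: "p \<in> S"
  shows "Dt w p = Ds Z p + (w p * Ds w p + w p * Ds w p) + \<kappa> p * \<kappa> p * w p"
proof -
  note ww = smooth_on_mult[OF smooth_w smooth_w]
  have "Dt (Ds \<kappa>) p = Ds (Dt \<kappa>) p + (\<kappa> p)\<^sup>2 * Ds \<kappa> p"
    using Dt_Ds[OF smooth_curvature p] by simp
  also have "Ds (Dt \<kappa>) p = Ds (\<lambda>p. \<kappa> p * (Z p + w p * w p)) p"
    by (rule Ds_cong[OF Dt_curvature_eq p])
  also have "\<dots> = \<kappa> p * (Ds Z p + (w p * Ds w p + w p * Ds w p)) + \<kappa> p * w p * (Z p + w p * w p)"
    by (simp add: Ds_mult[OF smooth_curvature smooth_on_add[OF smooth_Z ww] p]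
        Ds_add[OF smooth_Z ww p] Ds_mult[OF smooth_w smooth_w p] Ds_curvature_eq[OF p])
  also have "Dt (Ds \<kappa>) p = Dt (\<lambda>p. \<kappa> p * w p) p"
    by (rule time_deriv_cong[OF Ds_curvature_eq p])
  also have "\<dots> = \<kappa> p * Dt w p + \<kappa> p * (Z p + w p * w p) * w p"
    by (simp add: Dt_mult[OF smooth_curvature smooth_w p] Dt_curvature_eq[OF p])
  finally have "\<kappa> p * Dt w p =
      \<kappa> p * (Ds Z p + (w p * Ds w p + w p * Ds w p) + \<kappa> p * \<kappa> p * w p)"
    by (simp add: Ds_curvature_eq[OF p] power2_eq_square algebra_simps)
  then show ?thesis
    using curvature_pos_strip[OF p] by (metis less_irrefl mult_left_cancel)
qed

lemma Ds_Z:
  assumes p: "p \<in> S"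
  shows "Ds Z p = Ds (Ds w) p + 2 * \<kappa> p * \<kappa> p * w p"
  unfolding Z_def[abs_def]
  by (simp add: Ds_add[OF smooth_Ds[OF smooth_w] smooth_on_mult[OF smooth_curvature smooth_curvature] p]
      Ds_mult[OF smooth_curvature smooth_curvature p] Ds_curvature_eq[OF p])

text \<open>The reaction terms collect to \<open>2 * (Ds w + \<kappa> * \<kappa>) * Z\<close> and so
  depend on \<open>Z\<close> alone. The model equation \<open>z' = 2 * z^2\<close> has the solution
  \<open>- 1 / (2 * t)\<close>, the source of the constant in the bound.\<close>

lemma Dt_Z:
  assumes p: "p \<in> S"
  shows "Dt Z p = Ds (Ds Z) p + 2 * w p * Ds Z p + 2 * (Z p)\<^sup>2"
proof -
  note kk = smooth_on_mult[OF smooth_curvature smooth_curvature]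
    and wDw = smooth_on_mult[OF smooth_w smooth_Ds[OF smooth_w]]
    and DZ = smooth_Ds[OF smooth_Z]
  have "Dt Z p = Dt (Ds w) p + 2 * \<kappa> p * Dt \<kappa> p"
    unfolding Z_def[abs_def]
    by (simp add: time_deriv_add[OF smooth_Ds[OF smooth_w] kk p] Dt_mult[OF smooth_curvature smooth_curvature p])
  also have "Dt (Ds w) p = Ds (Dt w) p + (\<kappa> p)\<^sup>2 * Ds w p"
    using Dt_Ds[OF smooth_w p] by simp
  also have "Ds (Dt w) p =
      Ds (\<lambda>p. Ds Z p + (w p * Ds w p + w p * Ds w p) + \<kappa> p * \<kappa> p * w p) p"
    by (rule Ds_cong[OF Dt_w p])
  also have "\<dots> = Ds (Ds Z) p + 2 * (w p * Ds (Ds w) p + Ds w p * Ds w p) +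
      (\<kappa> p * \<kappa> p * Ds w p + 2 * \<kappa> p * (\<kappa> p * w p) * w p)"
    by (simp only: Ds_add[OF smooth_on_add[OF DZ smooth_on_add[OF wDw wDw]] smooth_on_mult[OF kk smooth_w] p]
        Ds_add[OF DZ smooth_on_add[OF wDw wDw] p] Ds_add[OF wDw wDw p]
        Ds_mult[OF smooth_w smooth_Ds[OF smooth_w] p] Ds_mult[OF kk smooth_w p]
        Ds_mult[OF smooth_curvature smooth_curvature p] Ds_curvature_eq[OF p])
      (simp add: algebra_simps)
  finally show ?thesis
    by (simp add: Dt_curvature_eq[OF p] Ds_Z[OF p])
      (simp add: Z_def power2_eq_square algebra_simps)
qed

text \<open>The factor \<open>t\<close> replaces the barrier \<open>- 1 / (2 * t)\<close>, singular
  at time zero, by the constant \<open>- 1 / 2\<close>, so that a minimum over the closed slab can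
  be taken.\<close>

lemma Z_lower_bound:
  assumes t0: "0 < b" "b < T"
  shows "b * Z (x, b) \<ge> - 1 / 2"
proof -
  obtain L where L: "L > 0" "periodic L \<gamma>"
    by (rule obtain_period)
  note per = periodic_curvature[OF L(2)]
  have "periodic L w"
    using per periodic_Ds[OF L(2) per smooth_curvature] by (simp add: periodic_def w_def)
  then have perZ: "periodic L Z"
    using per periodic_Ds[OF L(2) _ smooth_w] by (simp add: periodic_def Z_def)
  define f where "f = (\<lambda>p. snd p * Z p)"
  have "continuous_on (UNIV \<times> {0..b}) f"
    unfolding f_def by (intro continuous_intros continuous_on_slab smooth_Z t0)
  moreover have "periodic L f"
    using perZ by (simp add: f_def periodic_def)
  ultimately obtain y t where t: "t \<in> {0..b}" and min: "\<And>z s. s \<in> {0..b} \<Longrightarrow> f (y, t) \<le> f (z, s)"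
    by (rule obtain_min[OF _ less_imp_le[OF t0(1)] t0(2) _ L(1)]) blast
  have "f (y, t) \<ge> - 1 / 2"
  proof (rule ccontr)
    assume "\<not> f (y, t) \<ge> - 1 / 2"
    then have neg: "t * Z (y, t) < - 1 / 2"
      by (simp add: f_def not_le)
    \<comment> \<open>At time zero the product \<open>t * Z\<close> vanishes, so it is not below
      \<open>- 1 / 2\<close>.\<close>
    then have t': "0 < t" "t < T" "t \<in> {0..<T}"
      using t t0 by (auto simp: less_le)
    have Zneg: "Z (y, t) < 0"
      using less_trans[OF neg, of 0] t'(1) by (simp add: mult_less_0_iff)
    have "Z (y, t) \<le> Z (z, t)" for z
      using min[OF t, of z] t'(1) by (simp add: f_def)
    then have "Ds Z (y, t) = 0 \<and> Ds (Ds Z) (y, t) \<ge> 0"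
      using spatial_min[OF smooth_Z t'(3)] by blast
    then have Zt: "Dt Z (y, t) \<ge> 2 * (Z (y, t))\<^sup>2"
      using Dt_Z[of "(y, t)"] t'(3) by simp
    have "((\<lambda>s. f (y, s)) has_vector_derivative t * Dt Z (y, t) + 1 * Z (y, t)) (at t within {0..<T})"
      unfolding f_def fst_conv snd_conv
      by (intro has_vector_derivative_mult has_vector_derivative_id
          has_vector_derivative_time_deriv[OF smooth_Z t'(3)])
    from deriv_nonpos_at_left_min[OF this t'(1,2)]
    have "t * Dt Z (y, t) + Z (y, t) \<le> 0"
      using min t by simp
    moreover have "t * (2 * (Z (y, t))\<^sup>2) \<le> t * Dt Z (y, t)"
      using Zt t'(1) by (intro mult_left_mono) auto
    \<comment> \<open>Both factors are negative by \<open>Zneg\<close> and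
      \<open>neg\<close>.\<close>
    ultimately have "Z (y, t) * (2 * (t * Z (y, t)) + 1) \<le> 0"
      by (simp add: power2_eq_square algebra_simps)
    moreover have "Z (y, t) * (2 * (t * Z (y, t)) + 1) > 0"
      using Zneg neg by (intro mult_neg_neg) auto
    ultimately show False by linarith
  qed
  also have "f (y, t) \<le> f (x, b)"
    using min[of b x] t0 by simp
  finally show ?thesis
    by (simp add: f_def)
qed

text \<open>Since \<open>Dt \<kappa> - (Ds \<kappa>)^2 / \<kappa> = \<kappa> * Z\<close>, this is
  the lower bound on \<open>Z\<close> multiplied by \<open>\<kappa> > 0\<close>.\<close>

lemma harnack:
  assumes t: "0 < t" "t < T"
  shows "Dt \<kappa> (x, t) + 1 / (2 * t) * \<kappa> (x, t) \<ge> (Ds \<kappa> (x, t))\<^sup>2 / \<kappa> (x, t)"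
proof -
  have p: "(x, t) \<in> S" using t by simp
  have k: "\<kappa> (x, t) > 0" by (rule curvature_pos_strip[OF p])
  have "Z (x, t) + 1 / (2 * t) \<ge> 0"
    using Z_lower_bound[OF t, of x] t by (simp add: field_simps)
  then have "\<kappa> (x, t) * (Z (x, t) + 1 / (2 * t)) \<ge> 0"
    using k by simp
  moreover have "(Ds \<kappa> (x, t))\<^sup>2 / \<kappa> (x, t) = \<kappa> (x, t) * (w (x, t) * w (x, t))"
    using k by (simp add: Ds_curvature_eq[OF p] power2_eq_square)
  ultimately show ?thesis
    by (simp add: Dt_curvature_eq[OF p] algebra_simps)
qed

end

theorem theorem1p1:
  fixes T :: real
    and \<gamma> N :: "real \<times> real \<Rightarrow> real ^ 2"
    and \<kappa> :: "real \<times> real \<Rightarrow> real"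
  assumes "closed_embedded_family T \<gamma>"
    and "unit_normal_field T \<gamma> N"
    and "is_curvature T \<gamma> N \<kappa>"
    and "curve_shortening_flow T \<gamma> N \<kappa>"
    and convex: "\<And>x. \<kappa> (x, 0) > 0"
  shows "\<forall>t\<in>{0<..<T}. \<forall>x.
           time_deriv T \<kappa> (x, t) + 1 / (2 * t) * \<kappa> (x, t) \<ge> (arc_deriv \<gamma> \<kappa> (x, t))\<^sup>2 / \<kappa> (x, t)"
proof -
  interpret convex_csf T \<gamma> N \<kappa>
    by unfold_locales (fact assms)+
  show ?thesis
    using harnack by simp
qed

end
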